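(* There exist $d_0, C \in \mathbb{N}$ such that for every integer $d \ge d_0$ and every graph $G$ with minimum degree $d$, there is some $\ell \ge \sqrt{d} - C d^{1/4} \sqrt{\log d}$ such that $G$ contains an $\mathcal{S}_\ell$-factor; that is, $G$ contains a collection of pairwise vertex-disjoint stars, each of size at least $\ell$, which together cover all the vertices of $G$.
   Context: Graphs are finite and simple; $\log$ is the natural logarithm. A star of size $k$ is a complete bipartite graph with a single vertex on one side (the centre) and $k$ vertices on the other (the leaves). $\mathcal{S}_\ell$ denotes the family of all stars of size at least $\ell$. For a family $\mathcal{H}$ of graphs, an $\mathcal{H}$-packing in $G$ is a collection of pairwise vertex-disjoint (not necessarily induced) subgraphs of $G$, each isomorphic to a member of $\mathcal{H}$; an $\mathcal{H}$-factor is an $\mathcal{H}$-packing which covers all the vertices of $G$. *)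

theory Defs
  imports Complex_Main "Graph_Theory.Graph_Theory"
begin

text \<open>
  Finite simple graphs are the instances of the locale \<^locale>\<open>graph\<close>: finite, loop-free,
  symmetric digraphs without parallel arcs, every undirected edge being a pair of opposite arcs.
  In such a digraph \<^term>\<open>out_degree G v\<close> is the number of neighbours of \<open>v\<close>.
\<close>

text \<open>Only meaningful when \<^term>\<open>verts G\<close> is finite and nonempty.\<close>

definition min_degree :: "('a, 'b) pre_digraph \<Rightarrow> nat" where
  "min_degree G = Min (out_degree G ` verts G)"

definition stars_at_least :: "nat \<Rightarrow> ('a, 'b) pre_digraph set" where
  "stars_at_least l = {S. \<exists>k\<ge>l. complete_bipartite_digraph 1 k S}"

definition is_packing :: "('a, 'b) pre_digraph set \<Rightarrow> ('a, 'b) pre_digraph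
    \<Rightarrow> ('a, 'b) pre_digraph set \<Rightarrow> bool" where
  "is_packing \<H> G P \<longleftrightarrow>
     (\<forall>H\<in>P. subgraph H G \<and> (\<exists>F\<in>\<H>. digraph_iso H F)) \<and>
     pairwise (\<lambda>H K. verts H \<inter> verts K = {}) P"

definition is_factor :: "('a, 'b) pre_digraph set \<Rightarrow> ('a, 'b) pre_digraph
    \<Rightarrow> ('a, 'b) pre_digraph set \<Rightarrow> bool" where
  "is_factor \<H> G P \<longleftrightarrow> is_packing \<H> G P \<and> (\<Union>H\<in>P. verts H) = verts G"

end

theory Submission
  imports Defs
begin

text \<open>
  Write \<open>s\<close> for the integer part of the fourth root of \<open>d\<close>, and put \<open>l = s\<^sup>2 - 2s\<close> and \<open>K = sl\<close>.
  It is enough to find a set \<open>C\<close> of centres such that every other vertex has a neighbour in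
  \<open>C\<close> and such that every \<open>X \<subseteq> C\<close> has at least \<open>l |X|\<close> neighbours outside \<open>C\<close>: Hall's
  theorem then gives each centre \<open>l\<close> private leaves, and the remaining vertices join any
  neighbouring centre.

  The centres come from a maximisation. Among all pairs of disjoint vertex sets \<open>R\<close>, \<open>Q\<close>, let
  \<open>RL\<close> be the vertices outside \<open>R \<union> Q\<close> that have a neighbour in \<open>R\<close>, and \<open>QL\<close> those that have
  a neighbour in \<open>Q\<close> but none in \<open>R\<close>; choose the pair that maximises
  \<open>2 (|RL| - K |R|) + (|QL| - l |Q|)\<close>.
  So \<open>R\<close> consists of centres of big stars, of size about \<open>K\<close>, and \<open>Q\<close> of centres of
  stars of the target size \<open>l\<close>. Let \<open>U\<close> be the set of vertices outside all of these, and take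
  \<open>C = R \<union> Q \<union> U\<close>. Optimality has four consequences, one for each way of changing the pair.
  Deleting \<open>X \<subseteq> R\<close> shows that \<open>X\<close> has at least \<open>K |X|\<close> neighbours in \<open>RL\<close>; deleting
  \<open>X \<subseteq> Q\<close> shows that \<open>X\<close> has at least \<open>l |X|\<close> neighbours in \<open>QL\<close>. Moving a vertex to \<open>R\<close> shows
  that no vertex has more than \<open>2K + 3\<close> neighbours in \<open>QL \<union> U\<close>; moving a vertex to \<open>Q\<close> shows
  that no vertex has more than \<open>l + 3\<close> neighbours in \<open>U\<close>.

  A vertex of \<open>U\<close> has no neighbour in \<open>R \<union> Q\<close>, hence at least \<open>d - 2K - 3\<close> neighbours in \<open>RL\<close>,
  and each vertex of \<open>RL\<close> is wanted by at most \<open>l + 3\<close> vertices of \<open>U\<close>. As \<open>d\<close> is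
  about \<open>l\<^sup>2\<close> and \<open>K\<close> is of lower order, this leaves about \<open>l\<close> leaves for every vertex of \<open>U\<close>.
  The only competitors are the vertices of \<open>R\<close>, which want \<open>l\<close> out of a supply of \<open>K = sl\<close> leaves
  each; reserving for them a share \<open>1/s\<close> of every vertex of \<open>RL\<close> costs \<open>U\<close> only a factor
  \<open>1 - 1/s\<close>. The vertices of \<open>Q\<close> use the disjoint supply \<open>QL\<close>.
  The loss altogether is of order \<open>s\<close>, that is, \<open>d\<close> to the power \<open>1/4\<close>.
\<close>

section \<open>Hall's theorem\<close>

text \<open>
  The induction of Halmos and Vaughan: either some proper subfamily is tight, and then
  it and the rest, with the elements of the tight part deleted, can be treated separately, or there
  is room to spend an arbitrary element on an arbitrary index.
\<close>

theorem hall_marriage: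
  fixes A :: "'i \<Rightarrow> 'b set"
  assumes "finite I" and "\<And>i. i \<in> I \<Longrightarrow> finite (A i)"
    and "\<And>J. J \<subseteq> I \<Longrightarrow> card J \<le> card (\<Union>(A ` J))"
  shows "\<exists>f. inj_on f I \<and> (\<forall>i\<in>I. f i \<in> A i)"
  using assms
proof (induction I arbitrary: A rule: finite_psubset_induct)
  case (psubset I)
  note fin = psubset.prems(1) and hall = psubset.prems(2)
  have finU: "finite (\<Union>(A ` J))" if "J \<subseteq> I" for J
    using that fin psubset.hyps by (auto intro: finite_subset)
  show ?case
  proof (cases "\<exists>J. J \<noteq> {} \<and> J \<subset> I \<and> card (\<Union>(A ` J)) = card J")
    case True
    then obtain J where J: "J \<noteq> {}" "J \<subset> I" "card (\<Union>(A ` J)) = card J" by blast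
    have "\<exists>f. inj_on f J \<and> (\<forall>i\<in>J. f i \<in> A i)"
    proof (rule psubset.IH[OF J(2)])
      show "finite (A i)" if "i \<in> J" for i using that J(2) fin by blast
      show "card M \<le> card (\<Union>(A ` M))" if "M \<subseteq> J" for M using that J(2) hall by simp
    qed
    then obtain f where f: "inj_on f J" "\<forall>i\<in>J. f i \<in> A i" by blast
    define B where "B i = A i - \<Union>(A ` J)" for i
    have "\<exists>g. inj_on g (I - J) \<and> (\<forall>i\<in>I - J. g i \<in> B i)"
    proof (rule psubset.IH)
      show "I - J \<subset> I" using J by blast
      show "finite (B i)" if "i \<in> I - J" for i using that fin by (auto simp: B_def)
      show "card M \<le> card (\<Union>(B ` M))" if M: "M \<subseteq> I - J" for M
      proof -
        have fM: "finite M" "finite J" using M J psubset.hyps finite_subset by blast+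
        have "card M + card J = card (M \<union> J)"
          using M fM by (subst card_Un_disjoint) auto
        also have "\<dots> \<le> card (\<Union>(A ` (M \<union> J)))" using hall[of "M \<union> J"] M J by blast
        also have "\<Union>(A ` (M \<union> J)) = \<Union>(B ` M) \<union> \<Union>(A ` J)" by (auto simp: B_def)
        also have "card \<dots> \<le> card (\<Union>(B ` M)) + card (\<Union>(A ` J))" by (rule card_Un_le)
        finally show ?thesis using J(3) by simp
      qed
    qed
    then obtain g where g: "inj_on g (I - J)" "\<forall>i\<in>I - J. g i \<in> B i" by blast
    define h where "h i = (if i \<in> J then f i else g i)" for i
    have "h i \<in> A i" if "i \<in> I" for i using that f g by (auto simp: h_def B_def)
    moreover have "inj_on h I"
    proof (rule inj_onI)
      fix x y assume xy: "x \<in> I" "y \<in> I" "h x = h y"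
      have disjoint: "f j \<noteq> g z" if "j \<in> J" "z \<in> I - J" for j z
      proof -
        have "f j \<in> \<Union>(A ` J)" using f(2) that(1) by blast
        moreover have "g z \<notin> \<Union>(A ` J)" using g(2) that(2) by (simp add: B_def)
        ultimately show ?thesis by metis
      qed
      show "x = y"
      proof (cases "x \<in> J"; cases "y \<in> J")
        assume "x \<in> J" "y \<in> J"
        then show ?thesis using xy(3) inj_onD[OF f(1)] by (simp add: h_def)
      next
        assume "x \<in> J" "y \<notin> J"
        then show ?thesis using xy disjoint[of x y] by (simp add: h_def)
      next
        assume "x \<notin> J" "y \<in> J"
        then show ?thesis using xy disjoint[of y x] by (simp add: h_def)
      next
        assume "x \<notin> J" "y \<notin> J"
        then show ?thesis using xy inj_onD[OF g(1)] by (simp add: h_def)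
      qed
    qed
    ultimately show ?thesis by blast
  next
    case False
    show ?thesis
    proof (cases "I = {}")
      case False
      then obtain i where i: "i \<in> I" by blast
      have "card {i} \<le> card (\<Union>(A ` {i}))" using hall[of "{i}"] i by blast
      then obtain x where x: "x \<in> A i" by fastforce
      have "\<exists>g. inj_on g (I - {i}) \<and> (\<forall>j\<in>I - {i}. g j \<in> A j - {x})"
      proof (rule psubset.IH)
        show "I - {i} \<subset> I" using i by blast
        show "finite (A j - {x})" if "j \<in> I - {i}" for j using that fin by auto
        show "card M \<le> card (\<Union>j\<in>M. A j - {x})" if M: "M \<subseteq> I - {i}" for M
        proof (cases "M = {}")
          case False
          have "card (\<Union>(A ` M)) \<noteq> card M" "card M \<le> card (\<Union>(A ` M))"
            using \<open>\<nexists>J. J \<noteq> {} \<and> J \<subset> I \<and> card (\<Union>(A ` J)) = card J\<close> hall[of M] M i False by blast+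
          then have "card M \<le> card (\<Union>(A ` M)) - 1" by linarith
          also have "\<dots> \<le> card (\<Union>(A ` M) - {x})" by (simp add: card_Diff_singleton_if)
          also have "\<Union>(A ` M) - {x} = (\<Union>j\<in>M. A j - {x})" by auto
          finally show ?thesis .
        qed simp
      qed
      then obtain g where g: "inj_on g (I - {i})" "\<forall>j\<in>I - {i}. g j \<in> A j - {x}" by blast
      have "inj_on (g(i := x)) I" using g by (auto simp: inj_on_def)
      moreover have "\<forall>j\<in>I. (g(i := x)) j \<in> A j" using g x by auto
      ultimately show ?thesis by blast
    qed auto
  qed
qed

text \<open>
  Hall's theorem for a family in which every index occurs \<open>l\<close> times; the index of the set
  that contains a chosen element is recorded by the function \<open>a\<close>.
\<close>

corollary hall_marriage_multiple:
  fixes A :: "'i \<Rightarrow> 'b set"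
  assumes "finite I" and fin: "\<And>i. i \<in> I \<Longrightarrow> finite (A i)"
    and hall: "\<And>J. J \<subseteq> I \<Longrightarrow> l * card J \<le> card (\<Union>(A ` J))"
  obtains M a where "M \<subseteq> \<Union>(A ` I)" "\<And>x. x \<in> M \<Longrightarrow> a x \<in> I \<and> x \<in> A (a x)"
    "\<And>i. i \<in> I \<Longrightarrow> card {x \<in> M. a x = i} = l"
proof -
  have "\<exists>f. inj_on f (I \<times> {..<l}) \<and> (\<forall>p\<in>I \<times> {..<l}. f p \<in> A (fst p))"
  proof (rule hall_marriage)
    show "finite (I \<times> {..<l})" using assms by simp
    show "finite (A (fst p))" if "p \<in> I \<times> {..<l}" for p using that fin by auto
    show "card J \<le> card (\<Union>p\<in>J. A (fst p))" if J: "J \<subseteq> I \<times> {..<l}" for J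
    proof -
      have sub: "fst ` J \<subseteq> I" using J by auto
      have "card J \<le> card (fst ` J \<times> {..<l})"
      proof (rule card_mono)
        show "finite (fst ` J \<times> {..<l})" using sub \<open>finite I\<close> finite_subset by blast
        show "J \<subseteq> fst ` J \<times> {..<l}" using J by force
      qed
      also have "\<dots> = l * card (fst ` J)" by (simp add: card_cartesian_product)
      also have "\<dots> \<le> card (\<Union>(A ` (fst ` J)))" by (rule hall[OF sub])
      finally show ?thesis by (simp add: image_image)
    qed
  qed
  then obtain f where f: "inj_on f (I \<times> {..<l})" "\<And>p. p \<in> I \<times> {..<l} \<Longrightarrow> f p \<in> A (fst p)"
    by blast
  define M where "M = f ` (I \<times> {..<l})"
  define a where "a x = fst (the_inv_into (I \<times> {..<l}) f x)" for x
  have a_f: "a (f p) = fst p" if "p \<in> I \<times> {..<l}" for p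
    using the_inv_into_f_f[OF f(1) that] by (simp add: a_def)
  show ?thesis
  proof
    show "M \<subseteq> \<Union>(A ` I)" using f(2) by (fastforce simp: M_def)
    show "a x \<in> I \<and> x \<in> A (a x)" if "x \<in> M" for x
      using that a_f f(2) by (fastforce simp: M_def)
    show "card {x \<in> M. a x = i} = l" if "i \<in> I" for i
    proof -
      have "{x \<in> M. a x = i} = f ` ({i} \<times> {..<l})"
        using that a_f by (fastforce simp: M_def)
      moreover have "inj_on f ({i} \<times> {..<l})" using f(1) that by (auto simp: inj_on_def)
      ultimately show ?thesis by (simp add: card_image)
    qed
  qed
qed

section \<open>Choosing the centres\<close>

text \<open>Both sides bound the number of edges between \<open>X\<close> and its neighbours in \<open>B\<close>.\<close>

lemma card_neighbours_ge_double_counting: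
  fixes p q :: nat
  assumes "finite X" "finite B"
    and p: "\<And>x. x \<in> X \<Longrightarrow> p \<le> card {b \<in> B. E x b}"
    and q: "\<And>b. b \<in> B \<Longrightarrow> card {x \<in> X. E x b} \<le> q"
  shows "p * card X \<le> q * card {b \<in> B. \<exists>x\<in>X. E x b}"
proof -
  let ?B = "{b \<in> B. \<exists>x\<in>X. E x b}"
  have "p * card X = (\<Sum>x\<in>X. p)" by simp
  also have "\<dots> \<le> (\<Sum>x\<in>X. card {b \<in> ?B. E x b})"
  proof (rule sum_mono)
    fix x assume "x \<in> X"
    then have "{b \<in> ?B. E x b} = {b \<in> B. E x b}" by blast
    then show "p \<le> card {b \<in> ?B. E x b}" using p[OF \<open>x \<in> X\<close>] by simp
  qed
  also have "\<dots> = (\<Sum>b\<in>?B. card {x \<in> X. E x b})"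
    using sum.swap_restrict[of X ?B "\<lambda>_ _. 1::nat" E] assms(1,2) by simp
  also have "\<dots> \<le> (\<Sum>b\<in>?B. q)" by (rule sum_mono) (use q in blast)
  finally show ?thesis by (simp add: mult.commute)
qed

locale neighbourhoods =
  fixes V :: "'v set" and N :: "'v \<Rightarrow> 'v set"
  assumes finite_V: "finite V"
    and N_sub: "v \<in> V \<Longrightarrow> N v \<subseteq> V"
    and N_irrefl: "v \<notin> N v"
    and N_sym: "u \<in> N v \<Longrightarrow> v \<in> N u"
begin

definition nbrs :: "'v set \<Rightarrow> 'v set" where
  "nbrs X = \<Union>(N ` X)"

definition RL :: "'v set \<Rightarrow> 'v set \<Rightarrow> 'v set" where
  "RL R Q = nbrs R - (R \<union> Q)"

definition QL :: "'v set \<Rightarrow> 'v set \<Rightarrow> 'v set" where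
  "QL R Q = nbrs Q - (R \<union> Q \<union> nbrs R)"

definition uncovered :: "'v set \<Rightarrow> 'v set \<Rightarrow> 'v set" where
  "uncovered R Q = V - (R \<union> Q \<union> nbrs R \<union> nbrs Q)"

text \<open>
  The factor \<open>2\<close> is there for the sake of \<open>optimal_insert_R\<close>: it makes a vertex more valuable in
  \<open>RL\<close> than in \<open>QL\<close>, so that a new big star pays even if it takes all its leaves from \<open>QL\<close>.
\<close>

definition weight :: "nat \<Rightarrow> nat \<Rightarrow> 'v set \<Rightarrow> 'v set \<Rightarrow> int" where
  "weight K l R Q = 2 * (int (card (RL R Q)) - int K * int (card R))
     + (int (card (QL R Q)) - int l * int (card Q))"

definition admissible :: "'v set \<Rightarrow> 'v set \<Rightarrow> bool" where
  "admissible R Q \<longleftrightarrow> R \<subseteq> V \<and> Q \<subseteq> V \<and> R \<inter> Q = {}"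

definition optimal :: "nat \<Rightarrow> nat \<Rightarrow> 'v set \<Rightarrow> 'v set \<Rightarrow> bool" where
  "optimal K l R Q \<longleftrightarrow> admissible R Q \<and>
     (\<forall>R' Q'. admissible R' Q' \<longrightarrow> weight K l R' Q' \<le> weight K l R Q)"

lemma nbrs_sub: "X \<subseteq> V \<Longrightarrow> nbrs X \<subseteq> V"
  using N_sub by (auto simp: nbrs_def)

lemma optimal_sub: "optimal K l R Q \<Longrightarrow> R \<subseteq> V" "optimal K l R Q \<Longrightarrow> Q \<subseteq> V"
  by (auto simp: optimal_def admissible_def)

lemma finite_parts:
  assumes "optimal K l R Q"
  shows "finite R" "finite Q" "finite (RL R Q)" "finite (QL R Q)" "finite (uncovered R Q)"
proof -
  note sub = optimal_sub[OF assms]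
  have "RL R Q \<subseteq> V" "QL R Q \<subseteq> V" "uncovered R Q \<subseteq> V"
    using nbrs_sub[OF sub(1)] nbrs_sub[OF sub(2)] by (auto simp: RL_def QL_def uncovered_def)
  then show "finite R" "finite Q" "finite (RL R Q)" "finite (QL R Q)" "finite (uncovered R Q)"
    using sub finite_V finite_subset by blast+
qed

lemma finite_leaves:
  assumes "admissible R Q"
  shows "finite (RL R Q)" "finite (QL R Q)"
proof -
  have "RL R Q \<subseteq> V" "QL R Q \<subseteq> V"
    using nbrs_sub[of R] nbrs_sub[of Q] assms by (auto simp: RL_def QL_def admissible_def)
  then show "finite (RL R Q)" "finite (QL R Q)" using finite_V finite_subset by blast+
qed

lemma ex_optimal: "\<exists>R Q. optimal K l R Q"
proof -
  let ?S = "{p. admissible (fst p) (snd p)}"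
  let ?w = "\<lambda>p. weight K l (fst p) (snd p)"
  have "?S \<subseteq> Pow V \<times> Pow V" by (auto simp: admissible_def)
  then have fin: "finite ?S" using finite_V by (meson finite_Pow_iff finite_SigmaI finite_subset)
  have "({}, {}) \<in> ?S" by (simp add: admissible_def)
  then have "Max (?w ` ?S) \<in> ?w ` ?S" using fin by (intro Max_in) auto
  then obtain p where p: "p \<in> ?S" "?w p = Max (?w ` ?S)" by fastforce
  have "?w q \<le> ?w p" if "q \<in> ?S" for q using that fin p by simp
  then have "optimal K l (fst p) (snd p)" using p(1) by (auto simp: optimal_def)
  then show ?thesis by blast
qed

text \<open>
  Deleting \<open>X\<close> from \<open>R\<close> saves \<open>K\<close> for each element of \<open>X\<close> and hurts only those vertices
  of \<open>RL\<close> that are adjacent to \<open>X\<close>.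
\<close>

lemma optimal_delete_R:
  assumes opt: "optimal K l R Q" and X: "X \<subseteq> R"
  shows "K * card X \<le> card (nbrs X \<inter> RL R Q)"
proof -
  note fin = finite_parts[OF opt]
  have adm: "admissible (R - X) Q" using opt by (auto simp: optimal_def admissible_def)
  note fin' = finite_leaves[OF adm]
  have "RL R Q - (nbrs X \<inter> RL R Q) \<subseteq> RL (R - X) Q" by (auto simp: RL_def nbrs_def)
  then have "card (RL R Q - (nbrs X \<inter> RL R Q)) \<le> card (RL (R - X) Q)"
    using fin' by (intro card_mono)
  moreover have "card (RL R Q - (nbrs X \<inter> RL R Q)) = card (RL R Q) - card (nbrs X \<inter> RL R Q)"
    using fin by (intro card_Diff_subset) auto
  ultimately have 1: "int (card (RL R Q)) \<le> card (RL (R - X) Q) + int (card (nbrs X \<inter> RL R Q))"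
    by linarith
  have "QL R Q \<subseteq> QL (R - X) Q" by (auto simp: QL_def nbrs_def)
  then have 2: "card (QL R Q) \<le> card (QL (R - X) Q)" using fin' by (intro card_mono)
  have "card (R - X) + card X = card R"
    using X fin by (metis card_Diff_subset card_mono finite_subset le_add_diff_inverse2)
  then have "int (card R) = int (card (R - X)) + int (card X)" by linarith
  then have 3: "int K * int (card R) = int K * int (card (R - X)) + int K * int (card X)"
    by (simp add: distrib_left)
  have "weight K l (R - X) Q \<le> weight K l R Q" using opt adm by (auto simp: optimal_def)
  then have "int K * int (card X) \<le> int (card (nbrs X \<inter> RL R Q))"
    using 1 2 3 by (simp add: weight_def)
  then show ?thesis by (metis of_nat_le_iff of_nat_mult)
qed

text \<open>
  The same exchange for \<open>Q\<close>. A vertex of \<open>RL\<close> is protected here by its neighbour in \<open>R\<close>, so only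
  \<open>QL\<close> can lose.
\<close>

lemma optimal_delete_Q:
  assumes opt: "optimal K l R Q" and X: "X \<subseteq> Q"
  shows "l * card X \<le> card (nbrs X \<inter> QL R Q)"
proof -
  note fin = finite_parts[OF opt]
  have adm: "admissible R (Q - X)" using opt by (auto simp: optimal_def admissible_def)
  note fin' = finite_leaves[OF adm]
  have "QL R Q - (nbrs X \<inter> QL R Q) \<subseteq> QL R (Q - X)" by (auto simp: QL_def nbrs_def)
  then have "card (QL R Q - (nbrs X \<inter> QL R Q)) \<le> card (QL R (Q - X))"
    using fin' by (intro card_mono)
  moreover have "card (QL R Q - (nbrs X \<inter> QL R Q)) = card (QL R Q) - card (nbrs X \<inter> QL R Q)"
    using fin by (intro card_Diff_subset) auto
  ultimately have 1: "int (card (QL R Q)) \<le> card (QL R (Q - X)) + int (card (nbrs X \<inter> QL R Q))"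
    by linarith
  have "RL R Q \<subseteq> RL R (Q - X)" by (auto simp: RL_def nbrs_def)
  then have 2: "card (RL R Q) \<le> card (RL R (Q - X))" using fin' by (intro card_mono)
  have "card (Q - X) + card X = card Q"
    using X fin by (metis card_Diff_subset card_mono finite_subset le_add_diff_inverse2)
  then have "int (card Q) = int (card (Q - X)) + int (card X)" by linarith
  then have 3: "int l * int (card Q) = int l * int (card (Q - X)) + int l * int (card X)"
    by (simp add: distrib_left)
  have "weight K l R (Q - X) \<le> weight K l R Q" using opt adm by (auto simp: optimal_def)
  then have "int l * int (card X) \<le> int (card (nbrs X \<inter> QL R Q))"
    using 1 2 3 by (simp add: weight_def)
  then show ?thesis by (metis of_nat_le_iff of_nat_mult)
qed

text \<open>
  Moving \<open>v\<close> to \<open>R\<close> turns its neighbours in \<open>QL \<union> uncovered\<close> into vertices of \<open>RL\<close>. Each of them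
  gains at least \<open>1\<close>, because leaves in \<open>RL\<close> count double; the price is \<open>2K\<close> for the new
  element of \<open>R\<close> and at most \<open>3\<close> for the loss of \<open>v\<close> itself as a leaf.
\<close>

lemma optimal_insert_R:
  assumes opt: "optimal K l R Q" and v: "v \<in> V"
  shows "card (N v \<inter> (QL R Q \<union> uncovered R Q)) \<le> 2 * K + 3"
proof (cases "v \<in> R")
  case True
  then have "N v \<inter> (QL R Q \<union> uncovered R Q) = {}"
    by (auto simp: QL_def uncovered_def nbrs_def)
  then show ?thesis by simp
next
  case False
  let ?W = "N v \<inter> (QL R Q \<union> uncovered R Q)"
  note fin = finite_parts[OF opt]
  have adm: "admissible (insert v R) (Q - {v})"
    using opt v by (auto simp: optimal_def admissible_def)
  note fin' = finite_leaves[OF adm]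
  have "(RL R Q - {v}) \<union> ?W \<subseteq> RL (insert v R) (Q - {v})"
    using N_irrefl by (auto simp: RL_def QL_def uncovered_def nbrs_def)
  then have "card ((RL R Q - {v}) \<union> ?W) \<le> card (RL (insert v R) (Q - {v}))"
    using fin' by (intro card_mono)
  moreover have "card ((RL R Q - {v}) \<union> ?W) = card (RL R Q - {v}) + card ?W"
    using fin by (intro card_Un_disjoint) (auto simp: RL_def QL_def uncovered_def)
  moreover have "card (RL R Q) \<le> card (RL R Q - {v}) + 1"
    using diff_card_le_card_Diff[of "{v}" "RL R Q"] by simp
  ultimately have 1: "card (RL R Q) + card ?W \<le> card (RL (insert v R) (Q - {v})) + 1"
    by linarith
  have "QL R Q \<subseteq> QL (insert v R) (Q - {v}) \<union> insert v ?W"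
    by (auto simp: QL_def nbrs_def)
  then have "card (QL R Q) \<le> card (QL (insert v R) (Q - {v}) \<union> insert v ?W)"
    using fin fin' by (intro card_mono) auto
  also have "\<dots> \<le> card (QL (insert v R) (Q - {v})) + card (insert v ?W)"
    by (rule card_Un_le)
  also have "card (insert v ?W) \<le> card ?W + 1"
    using fin by (simp add: card_insert_if)
  finally have 2: "card (QL R Q) \<le> card (QL (insert v R) (Q - {v})) + card ?W + 1" by simp
  have 3: "int K * int (card (insert v R)) = int K * int (card R) + int K"
    using False fin by (simp add: algebra_simps)
  have "card (Q - {v}) \<le> card Q" using fin by (intro card_mono) auto
  then have 4: "int l * int (card (Q - {v})) \<le> int l * int (card Q)"
    by (intro mult_left_mono) auto
  have "weight K l (insert v R) (Q - {v}) \<le> weight K l R Q"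
    using opt adm by (auto simp: optimal_def)
  then show ?thesis using 1 2 3 4 by (simp add: weight_def)
qed

text \<open>
  Moving \<open>v\<close> to \<open>Q\<close> gains \<open>1\<close> for each uncovered neighbour. The price is \<open>l\<close> for the new element of
  \<open>Q\<close> and at most \<open>3\<close> for the loss of \<open>v\<close> itself as a leaf.
\<close>

lemma optimal_insert_Q:
  assumes opt: "optimal K l R Q" and v: "v \<in> V"
  shows "card (N v \<inter> uncovered R Q) \<le> l + 3"
proof (cases "v \<in> R \<union> Q")
  case True
  then have "N v \<inter> uncovered R Q = {}" by (auto simp: uncovered_def nbrs_def)
  then show ?thesis by simp
next
  case False
  let ?U = "N v \<inter> uncovered R Q"
  note fin = finite_parts[OF opt]
  have adm: "admissible R (insert v Q)"
    using opt v False by (auto simp: optimal_def admissible_def)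
  note fin' = finite_leaves[OF adm]
  have "RL R Q - {v} \<subseteq> RL R (insert v Q)" by (auto simp: RL_def)
  then have "card (RL R Q - {v}) \<le> card (RL R (insert v Q))" using fin' by (intro card_mono)
  then have 1: "card (RL R Q) \<le> card (RL R (insert v Q)) + 1"
    by (simp add: card_Diff_singleton_if split: if_splits)
  have "(QL R Q - {v}) \<union> ?U \<subseteq> QL R (insert v Q)"
    using N_irrefl by (auto simp: QL_def uncovered_def nbrs_def)
  then have "card ((QL R Q - {v}) \<union> ?U) \<le> card (QL R (insert v Q))"
    using fin' by (intro card_mono)
  moreover have "card ((QL R Q - {v}) \<union> ?U) = card (QL R Q - {v}) + card ?U"
    using fin by (intro card_Un_disjoint) (auto simp: QL_def uncovered_def)
  moreover have "card (QL R Q) \<le> card (QL R Q - {v}) + 1"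
    using diff_card_le_card_Diff[of "{v}" "QL R Q"] by simp
  ultimately have 2: "card (QL R Q) + card ?U \<le> card (QL R (insert v Q)) + 1" by linarith
  have 3: "int l * int (card (insert v Q)) = int l * int (card Q) + int l"
    using False fin by (simp add: algebra_simps)
  have "weight K l R (insert v Q) \<le> weight K l R Q" using opt adm by (auto simp: optimal_def)
  then show ?thesis using 1 2 3 by (simp add: weight_def)
qed

text \<open>
  Every vertex of \<open>RL\<close> splits itself: a share \<open>1/s\<close> goes to \<open>R\<close> and the rest to the uncovered
  vertices. Multiplied by \<open>s\<close>, this is the inequality between the neighbourhood of
  \<open>X \<inter> (R \<union> U)\<close> and the neighbourhoods of the two parts. The hypothesis \<open>room\<close> says that
  the share \<open>1 - 1/s\<close> suffices for the uncovered vertices.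
\<close>

lemma ex_centres:
  assumes deg: "\<And>v. v \<in> V \<Longrightarrow> d \<le> card (N v)"
    and s: "s \<ge> 1"
    and room: "s * l * (l + 3) \<le> (s - 1) * (d - (2 * (s * l) + 3))"
  shows "\<exists>C\<subseteq>V. (\<forall>v\<in>V - C. N v \<inter> C \<noteq> {}) \<and>
           (\<forall>X\<subseteq>C. l * card X \<le> card (nbrs X - C))"
proof -
  obtain R Q where opt: "optimal (s * l) l R Q" using ex_optimal by blast
  note sub = optimal_sub[OF opt] and fin = finite_parts[OF opt]
  define U where "U = uncovered R Q"
  define C where "C = R \<union> Q \<union> U"
  have CV: "C \<subseteq> V" using sub by (auto simp: C_def U_def uncovered_def)
  have dom: "N v \<inter> C \<noteq> {}" if "v \<in> V - C" for v
    using that N_sym by (fastforce simp: C_def U_def uncovered_def nbrs_def)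
  have leaves: "RL R Q \<inter> C = {}" "QL R Q \<inter> C = {}" "RL R Q \<inter> QL R Q = {}"
    by (auto simp: RL_def QL_def C_def U_def uncovered_def)
  have disj: "R \<inter> Q = {}" using opt by (auto simp: optimal_def admissible_def)
  have U_supply: "d - (2 * (s * l) + 3) \<le> card {b \<in> RL R Q. b \<in> N u}" if u: "u \<in> U" for u
  proof -
    have uV: "u \<in> V" using u by (auto simp: U_def uncovered_def)
    let ?W = "N u \<inter> (QL R Q \<union> uncovered R Q)"
    have "N u \<subseteq> {b \<in> RL R Q. b \<in> N u} \<union> ?W"
    proof
      fix b assume b: "b \<in> N u"
      then have "b \<in> V" using N_sub[OF uV] by blast
      moreover have "b \<notin> R \<union> Q" using u N_sym[OF b] by (auto simp: U_def uncovered_def nbrs_def)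
      ultimately show "b \<in> {b \<in> RL R Q. b \<in> N u} \<union> ?W"
        using b by (auto simp: RL_def QL_def uncovered_def)
    qed
    then have "card (N u) \<le> card ({b \<in> RL R Q. b \<in> N u} \<union> ?W)"
      using fin by (intro card_mono) auto
    also have "\<dots> \<le> card {b \<in> RL R Q. b \<in> N u} + card ?W" by (rule card_Un_le)
    finally show ?thesis using deg[OF uV] optimal_insert_R[OF opt uV] by linarith
  qed
  have hall: "l * card X \<le> card (nbrs X - C)" if X: "X \<subseteq> C" for X
  proof -
    define XR where "XR = X \<inter> R"
    define XQ where "XQ = X \<inter> Q"
    define XU where "XU = X \<inter> U"
    define A where "A = nbrs (XR \<union> XU) \<inter> RL R Q"
    have finX: "finite XR" "finite XQ" "finite XU" using fin by (auto simp: XR_def XQ_def XU_def U_def)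
    have card_X: "card X = card XR + card XQ + card XU"
    proof -
      have "X = (XR \<union> XQ) \<union> XU" using X by (auto simp: C_def XR_def XQ_def XU_def)
      also have "card \<dots> = card (XR \<union> XQ) + card XU"
        using finX by (intro card_Un_disjoint) (auto simp: XR_def XQ_def XU_def U_def uncovered_def)
      also have "card (XR \<union> XQ) = card XR + card XQ"
        using finX disj by (intro card_Un_disjoint) (auto simp: XR_def XQ_def)
      finally show ?thesis .
    qed
    have "(s * l) * card XR \<le> card (nbrs XR \<inter> RL R Q)"
      by (rule optimal_delete_R[OF opt]) (simp add: XR_def)
    also have "\<dots> \<le> card A" using fin by (intro card_mono) (auto simp: A_def nbrs_def)
    finally have R_part: "(s * l) * card XR \<le> card A" .
    have "(d - (2 * (s * l) + 3)) * card XU \<le> (l + 3) * card {b \<in> RL R Q. \<exists>x\<in>XU. b \<in> N x}"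
    proof (rule card_neighbours_ge_double_counting)
      show "card {x \<in> XU. b \<in> N x} \<le> l + 3" if b: "b \<in> RL R Q" for b
      proof -
        have "b \<in> V" using b nbrs_sub[OF sub(1)] by (auto simp: RL_def)
        then have "card (N b \<inter> uncovered R Q) \<le> l + 3" by (rule optimal_insert_Q[OF opt])
        moreover have "card {x \<in> XU. b \<in> N x} \<le> card (N b \<inter> uncovered R Q)"
          using fin N_sym by (intro card_mono) (auto simp: XU_def U_def)
        ultimately show ?thesis by linarith
      qed
    qed (use finX fin U_supply in \<open>auto simp: XU_def\<close>)
    also have "\<dots> \<le> (l + 3) * card A"
      using fin by (intro mult_left_mono card_mono) (auto simp: A_def nbrs_def)
    finally have U_part: "(d - (2 * (s * l) + 3)) * card XU \<le> (l + 3) * card A" .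
    have RU_part: "l * (card XR + card XU) \<le> card A"
    proof -
      have "(s * (l + 3)) * (l * (card XR + card XU))
          = (l + 3) * ((s * l) * card XR) + (s * l * (l + 3)) * card XU"
        by (simp add: algebra_simps)
      also have "\<dots> \<le> (l + 3) * card A + (s - 1) * ((d - (2 * (s * l) + 3)) * card XU)"
      proof (rule add_mono)
        show "(l + 3) * ((s * l) * card XR) \<le> (l + 3) * card A" using R_part by (rule mult_le_mono2)
        show "(s * l * (l + 3)) * card XU \<le> (s - 1) * ((d - (2 * (s * l) + 3)) * card XU)"
          using mult_le_mono1[OF room, of "card XU"] by (simp only: mult.assoc)
      qed
      also have "\<dots> \<le> (l + 3) * card A + (s - 1) * ((l + 3) * card A)"
        using mult_le_mono2[OF U_part, of "s - 1"] by simp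
      also have "\<dots> = (s * (l + 3)) * card A" using s by (cases s) (simp_all add: algebra_simps)
      finally show ?thesis using s by simp
    qed
    have Q_part: "l * card XQ \<le> card (nbrs XQ \<inter> QL R Q)"
      by (rule optimal_delete_Q[OF opt]) (simp add: XQ_def)
    have "l * card X \<le> card A + card (nbrs XQ \<inter> QL R Q)"
      using RU_part Q_part by (simp add: card_X algebra_simps)
    also have "\<dots> = card (A \<union> (nbrs XQ \<inter> QL R Q))"
      using fin leaves(3) by (subst card_Un_disjoint) (auto simp: A_def)
    also have "\<dots> \<le> card (nbrs X - C)"
    proof (rule card_mono)
      have "X \<subseteq> V" using X CV by blast
      then show "finite (nbrs X - C)" using nbrs_sub finite_V by (meson finite_Diff finite_subset)
      show "A \<union> (nbrs XQ \<inter> QL R Q) \<subseteq> nbrs X - C"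
        using leaves by (auto simp: A_def nbrs_def XR_def XQ_def XU_def)
    qed
    finally show ?thesis .
  qed
  show ?thesis using CV dom hall by blast
qed

text \<open>
  Hall's theorem accounts for only \<open>l\<close> leaves of each centre. Every vertex outside \<open>C\<close> that it leaves
  unused joins a neighbouring centre, which can only enlarge a star.
\<close>

lemma ex_star_assignment:
  assumes "\<And>v. v \<in> V \<Longrightarrow> d \<le> card (N v)" and "s \<ge> 1"
    and "s * l * (l + 3) \<le> (s - 1) * (d - (2 * (s * l) + 3))"
  obtains C a where "C \<subseteq> V" "\<And>v. v \<in> V - C \<Longrightarrow> a v \<in> C \<and> v \<in> N (a v)"
    "\<And>c. c \<in> C \<Longrightarrow> l \<le> card {v \<in> V - C. a v = c}"
proof -
  obtain C where C: "C \<subseteq> V" "\<And>v. v \<in> V - C \<Longrightarrow> N v \<inter> C \<noteq> {}"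
    and hall: "\<And>X. X \<subseteq> C \<Longrightarrow> l * card X \<le> card (nbrs X - C)"
    using ex_centres[OF assms] by blast
  have NV: "N c \<subseteq> V" if "c \<in> C" for c using N_sub C(1) that by blast
  obtain M a where M: "M \<subseteq> \<Union>((\<lambda>c. N c - C) ` C)"
    "\<And>x. x \<in> M \<Longrightarrow> a x \<in> C \<and> x \<in> N (a x) - C"
    "\<And>c. c \<in> C \<Longrightarrow> card {x \<in> M. a x = c} = l"
  proof (rule hall_marriage_multiple[of C "\<lambda>c. N c - C" l])
    show "finite C" using C(1) finite_V by (rule finite_subset)
    show "finite (N c - C)" if "c \<in> C" for c
      using NV[OF that] finite_V by (meson finite_Diff finite_subset)
    show "l * card X \<le> card (\<Union>c\<in>X. N c - C)" if "X \<subseteq> C" for X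
    proof -
      have "(\<Union>c\<in>X. N c - C) = nbrs X - C" by (auto simp: nbrs_def)
      then show ?thesis using hall[OF that] by simp
    qed
  qed blast
  have MV: "M \<subseteq> V - C" using M(1) NV by blast
  define a' where "a' v = (if v \<in> M then a v else SOME c. c \<in> N v \<inter> C)" for v
  show ?thesis
  proof
    show "C \<subseteq> V" by (rule C(1))
    show "a' v \<in> C \<and> v \<in> N (a' v)" if v: "v \<in> V - C" for v
    proof (cases "v \<in> M")
      case True
      then show ?thesis using M(2) by (simp add: a'_def)
    next
      case False
      have "(SOME c. c \<in> N v \<inter> C) \<in> N v \<inter> C" using C(2)[OF v] by (meson ex_in_conv someI_ex)
      then show ?thesis using False N_sym by (auto simp: a'_def)
    qed
    show "l \<le> card {v \<in> V - C. a' v = c}" if "c \<in> C" for c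
    proof -
      have "card {x \<in> M. a x = c} \<le> card {v \<in> V - C. a' v = c}"
        using MV finite_V by (intro card_mono) (auto simp: a'_def)
      then show ?thesis using M(3)[OF that] by simp
    qed
  qed
qed

end

section \<open>Stars as subgraphs\<close>

definition star_at :: "('a, 'b) pre_digraph \<Rightarrow> 'a \<Rightarrow> 'a set \<Rightarrow> ('a, 'b) pre_digraph" where
  "star_at G c L = \<lparr> verts = insert c L,
     arcs = {e \<in> arcs G. (tail G e, head G e) \<in> {c} \<times> L \<union> L \<times> {c}},
     tail = tail G, head = head G \<rparr>"

definition out_nbrs :: "('a, 'b) pre_digraph \<Rightarrow> 'a \<Rightarrow> 'a set" where
  "out_nbrs G v = {w. (v, w) \<in> arcs_ends G}"

lemma digraph_iso_refl:
  assumes "wf_digraph G"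
  shows "digraph_iso G G"
proof -
  let ?id = "\<lparr>iso_verts = id, iso_arcs = id, iso_head = head G, iso_tail = tail G\<rparr>"
  have "pre_digraph.digraph_isomorphism G ?id"
    using assms by (simp add: pre_digraph.digraph_isomorphism_def)
  moreover have "G = app_iso ?id G" by (simp add: app_iso_def)
  ultimately show ?thesis unfolding digraph_iso_def by blast
qed

context
  fixes G :: "('a, 'b) pre_digraph"
  assumes G: "Digraph.graph G"
begin

interpretation graph G by (rule G)

lemma arcs_ends_sym: "(u, v) \<in> arcs_ends G \<Longrightarrow> (v, u) \<in> arcs_ends G"
  using sym_arcs by (auto simp: symmetric_def dest: symD)

text \<open>The absence of parallel arcs identifies arcs leaving \<open>v\<close> with neighbours of \<open>v\<close>.\<close>

lemma card_out_nbrs: "card (out_nbrs G v) = out_degree G v"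
proof -
  have "out_nbrs G v = head G ` out_arcs G v"
    by (auto simp: out_nbrs_def arcs_ends_conv image_iff)
  moreover have "inj_on (head G) (out_arcs G v)"
    using no_multi_arcs by (auto simp: inj_on_def arc_to_ends_def)
  ultimately show ?thesis by (simp add: card_image out_degree_def)
qed

lemma neighbourhoods_out_nbrs: "neighbourhoods (verts G) (out_nbrs G)"
proof (rule neighbourhoods.intro)
  show "v \<notin> out_nbrs G v" for v
    using no_loops by (fastforce simp: out_nbrs_def arcs_ends_conv)
  show "out_nbrs G v \<subseteq> verts G" for v by (auto simp: out_nbrs_def arcs_ends_conv)
qed (auto simp: out_nbrs_def intro: arcs_ends_sym)

lemma star_at_is_star:
  assumes c: "c \<in> verts G" and L: "L \<subseteq> out_nbrs G c"
  shows "subgraph (star_at G c L) G"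
    and "complete_bipartite_digraph 1 (card L) (star_at G c L)"
proof -
  let ?S = "star_at G c L"
  have LV: "L \<subseteq> verts G" using L by (auto simp: out_nbrs_def arcs_ends_conv)
  have cL: "c \<notin> L" using L no_loops by (fastforce simp: out_nbrs_def arcs_ends_conv)
  have ends: "arcs_ends ?S = {c} \<times> L \<union> L \<times> {c}"
  proof
    show "arcs_ends ?S \<subseteq> {c} \<times> L \<union> L \<times> {c}" by (auto simp: star_at_def arcs_ends_conv)
    have "arcs_ends ?S = arcs_ends G \<inter> ({c} \<times> L \<union> L \<times> {c})"
      by (auto simp: star_at_def arcs_ends_conv)
    then show "{c} \<times> L \<union> L \<times> {c} \<subseteq> arcs_ends ?S"
      using L arcs_ends_sym by (auto simp: out_nbrs_def)
  qed
  have finS: "finite (verts ?S)" "finite (arcs ?S)"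
    using finite_subset[OF LV finite_verts] finite_arcs by (auto simp: star_at_def)
  interpret S: wf_digraph ?S by unfold_locales (auto simp: star_at_def)
  show "subgraph ?S G"
    using c LV S.wf_digraph wf_digraph by (auto simp: subgraph_def star_at_def compatible_def)
  have "graph ?S"
  proof
    show "finite (verts ?S)" "finite (arcs ?S)" by (fact finS)+
    show "tail ?S e \<noteq> head ?S e" if "e \<in> arcs ?S" for e
      using that no_loops by (auto simp: star_at_def)
    show "e1 = e2" if "e1 \<in> arcs ?S" "e2 \<in> arcs ?S" "arc_to_ends ?S e1 = arc_to_ends ?S e2" for e1 e2
      using that no_multi_arcs[of e1 e2] by (auto simp: star_at_def arc_to_ends_def)
    show "symmetric ?S" unfolding symmetric_def ends by (auto intro: symI)
  qed
  moreover have "verts ?S = {c} \<union> L \<and> {c} \<inter> L = {} \<and> card {c} = 1 \<and> card L = card L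
      \<and> arcs_ends ?S = {c} \<times> L \<union> L \<times> {c}"
    using ends cL by (simp add: star_at_def)
  ultimately show "complete_bipartite_digraph 1 (card L) ?S"
    unfolding complete_bipartite_digraph_def by blast
qed

lemma star_factor_of_assignment:
  assumes C: "C \<subseteq> verts G"
    and a: "\<And>v. v \<in> verts G - C \<Longrightarrow> a v \<in> C \<and> v \<in> out_nbrs G (a v)"
    and size: "\<And>c. c \<in> C \<Longrightarrow> l \<le> card {v \<in> verts G - C. a v = c}"
  shows "\<exists>P. is_factor (stars_at_least l) G P"
proof -
  define L where "L c = {v \<in> verts G - C. a v = c}" for c
  let ?P = "(\<lambda>c. star_at G c (L c)) ` C"
  have verts_star: "verts (star_at G c (L c)) = insert c (L c)" for c by (simp add: star_at_def)
  have star: "subgraph (star_at G c (L c)) G"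
      "complete_bipartite_digraph 1 (card (L c)) (star_at G c (L c))" if "c \<in> C" for c
  proof -
    have "c \<in> verts G" using that C by blast
    moreover have "L c \<subseteq> out_nbrs G c" using a by (auto simp: L_def)
    ultimately show "subgraph (star_at G c (L c)) G"
      "complete_bipartite_digraph 1 (card (L c)) (star_at G c (L c))"
      by (rule star_at_is_star)+
  qed
  have large: "star_at G c (L c) \<in> stars_at_least l" if "c \<in> C" for c
    using star(2)[OF that] size[OF that] unfolding stars_at_least_def L_def by blast
  have refl: "digraph_iso (star_at G c (L c)) (star_at G c (L c))" if "c \<in> C" for c
    using star(1)[OF that] by (intro digraph_iso_refl) (simp add: subgraph_def)
  have "pairwise (\<lambda>H K. verts H \<inter> verts K = {}) ?P"
  proof (rule pairwiseI)
    fix H K assume "H \<in> ?P" "K \<in> ?P" "H \<noteq> K"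
    then obtain c c' where c: "c \<in> C" "c' \<in> C" "c \<noteq> c'"
      and HK: "H = star_at G c (L c)" "K = star_at G c' (L c')" by blast
    have "insert c (L c) \<inter> insert c' (L c') = {}" using c by (auto simp: L_def)
    then show "verts H \<inter> verts K = {}" by (simp only: HK verts_star)
  qed
  moreover have "(\<Union>H\<in>?P. verts H) = verts G"
  proof -
    have "(\<Union>H\<in>?P. verts H) = (\<Union>c\<in>C. insert c (L c))" by (simp add: verts_star)
    also have "\<dots> = verts G" using C a by (auto simp: L_def)
    finally show ?thesis .
  qed
  moreover have "\<forall>H\<in>?P. subgraph H G \<and> (\<exists>F\<in>stars_at_least l :: ('a, 'b) pre_digraph set. digraph_iso H F)"
  proof
    fix H assume "H \<in> ?P"
    then obtain c where "c \<in> C" "H = star_at G c (L c)" by blast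
    then show "subgraph H G \<and> (\<exists>F\<in>stars_at_least l :: ('a, 'b) pre_digraph set. digraph_iso H F)"
      using star(1) large refl by metis
  qed
  ultimately have "is_factor (stars_at_least l) G ?P"
    by (simp only: is_factor_def is_packing_def simp_thms)
  then show ?thesis by blast
qed

lemma ex_star_factor:
  assumes "s \<ge> 1" and "s * l * (l + 3) \<le> (s - 1) * (min_degree G - (2 * (s * l) + 3))"
  shows "\<exists>P. is_factor (stars_at_least l) G P"
proof -
  interpret neighbourhoods "verts G" "out_nbrs G" by (rule neighbourhoods_out_nbrs)
  have "min_degree G \<le> card (out_nbrs G v)" if "v \<in> verts G" for v
    using that by (simp add: card_out_nbrs min_degree_def)
  then obtain C a where "C \<subseteq> verts G" "\<And>v. v \<in> verts G - C \<Longrightarrow> a v \<in> C \<and> v \<in> out_nbrs G (a v)"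
    "\<And>c. c \<in> C \<Longrightarrow> l \<le> card {v \<in> verts G - C. a v = c}"
    by (rule ex_star_assignment[OF _ assms]) blast+
  then show ?thesis by (rule star_factor_of_assignment)
qed

end

section \<open>The numerical estimates\<close>

text \<open>
  For \<open>d = s\<^sup>4\<close> both sides are polynomials in \<open>s\<close> with leading term \<open>s\<^sup>5\<close>. Taking \<open>2s\<close> away from \<open>s\<^sup>2\<close> is
  what makes the next coefficient \<open>-4\<close> on the left, below the \<open>-3\<close> on the right.
\<close>

lemma room_for_uncovered:
  fixes s d :: nat
  assumes s: "s \<ge> 2" and d: "s ^ 4 \<le> d"
  defines "l \<equiv> s * (s - 2)"
  shows "s * l * (l + 3) \<le> (s - 1) * (d - (2 * (s * l) + 3))"
proof -
  \<comment> \<open>In terms of \<open>t = s - 2\<close> no subtraction is left and the coefficients can be compared one by one.\<close>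
  obtain t where t: "s = t + 2" using s by (metis add.commute le_Suc_ex)
  have l: "l = (t + 2) * t" by (simp add: l_def t)
  have "s * l * (l + 3) \<le> (s - 1) * (s ^ 4 - (2 * (s * l) + 3))"
  proof -
    have "s ^ 4 = (2 * (s * l) + 3) + (t^4 + 6*t^3 + 16*t^2 + 24*t + 13)"
      by (simp add: t l eval_nat_numeral algebra_simps)
    then have eq: "s ^ 4 - (2 * (s * l) + 3) = t^4 + 6*t^3 + 16*t^2 + 24*t + 13"
      by linarith
    show ?thesis unfolding eq by (simp add: t l eval_nat_numeral algebra_simps)
  qed
  also have "\<dots> \<le> (s - 1) * (d - (2 * (s * l) + 3))"
    using d by (intro mult_le_mono2 diff_le_mono)
  finally show ?thesis .
qed

text \<open>
  The square root of \<open>d\<close> is below \<open>(s + 1)\<^sup>2\<close>, which exceeds \<open>s (s - 2)\<close> by \<open>4s + 1 \<le> 5s\<close>. The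
  logarithmic factor is at least \<open>1\<close> and only enlarges the error term.
\<close>

lemma star_size_estimate:
  fixes s d :: nat
  assumes s: "s \<ge> 2" "s ^ 4 \<le> d" "d < (s + 1) ^ 4"
  shows "real (s * (s - 2)) \<ge> sqrt (real d) - 5 * real d powr (1 / 4) * sqrt (ln (real d))"
proof -
  have "2 ^ 4 \<le> s ^ 4" using s(1) by (intro power_mono) auto
  then have d3: "d \<ge> 16" using s(2) by simp
  have "exp (1::real) \<le> real d" using exp_le d3 by linarith
  then have "1 \<le> ln (real d)" using d3 by (simp add: ln_ge_iff)
  then have log: "1 \<le> sqrt (ln (real d))" by simp
  have root: "real s \<le> real d powr (1 / 4)"
  proof -
    have "real s = real s powr (4 * (1 / 4))" by simp
    also have "\<dots> = (real s powr 4) powr (1 / 4)" by (simp only: powr_powr)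
    also have "\<dots> \<le> real d powr (1 / 4)"
    proof (rule powr_mono2)
      have "real (s ^ 4) \<le> real d" using s(2) by (simp only: of_nat_le_iff)
      then show "real s powr 4 \<le> real d" by simp
    qed simp_all
    finally show ?thesis .
  qed
  have "sqrt (real d) \<le> (real s + 1) ^ 2"
  proof (rule real_le_lsqrt)
    have "real d \<le> real ((s + 1) ^ 4)" using s(3) by (intro of_nat_mono) simp
    then show "real d \<le> ((real s + 1)\<^sup>2)\<^sup>2" by (simp add: add.commute)
  qed simp_all
  also have "\<dots> \<le> real (s * (s - 2)) + 5 * real s"
    using s(1) by (simp add: of_nat_diff power2_eq_square algebra_simps)
  also have "\<dots> \<le> real (s * (s - 2)) + 5 * (real d powr (1 / 4) * sqrt (ln (real d)))"
    using mult_mono[OF root log] by simp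
  finally show ?thesis by simp
qed

theorem theorem1p1:
  shows "\<exists>d0 C :: nat. \<forall>d\<ge>d0. \<forall>G :: ('a, 'b) pre_digraph.
           Digraph.graph G \<and> verts G \<noteq> {} \<and> min_degree G = d \<longrightarrow>
           (\<exists>l :: nat.
              real l \<ge> sqrt (real d) - real C * real d powr (1 / 4) * sqrt (ln (real d)) \<and>
              (\<exists>P. is_factor (stars_at_least l) G P))"
proof (rule exI[of _ 16], rule exI[of _ 5], intro allI impI)
  fix d :: nat and G :: "('a, 'b) pre_digraph"
  assume d: "16 \<le> d" and G: "Digraph.graph G \<and> verts G \<noteq> {} \<and> min_degree G = d"
  define s where "s = Max {n. n ^ 4 \<le> d}"
  have "n \<le> d" if "n ^ 4 \<le> d" for n
  proof (cases "n = 0")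
    case False
    then have "n \<le> n ^ 4" by (intro self_le_power) auto
    then show ?thesis using that by (rule order_trans)
  qed simp
  then have "{n. n ^ 4 \<le> d} \<subseteq> {..d}" by blast
  then have fin: "finite {n. n ^ 4 \<le> d}" using finite_subset by blast
  have two: "2 \<in> {n. n ^ 4 \<le> d}" using d by simp
  have s: "s ^ 4 \<le> d" using Max_in[OF fin] two unfolding s_def by blast
  have s2: "2 \<le> s" using Max_ge[OF fin two] by (simp add: s_def)
  have s1: "d < (s + 1) ^ 4"
  proof (rule ccontr)
    assume "\<not> d < (s + 1) ^ 4"
    then have "s + 1 \<in> {n. n ^ 4 \<le> d}" by simp
    from Max_ge[OF fin this] have "s + 1 \<le> s" by (simp only: s_def)
    then show False by simp
  qed
  let ?l = "s * (s - 2)"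
  have "\<exists>P. is_factor (stars_at_least ?l) G P"
  proof (rule ex_star_factor)
    show "Digraph.graph G" using G by simp
    show "1 \<le> s" using s2 by simp
    show "s * ?l * (?l + 3) \<le> (s - 1) * (min_degree G - (2 * (s * ?l) + 3))"
      using room_for_uncovered[OF s2 s] G by simp
  qed
  then show "\<exists>l. real l \<ge> sqrt (real d) - real 5 * real d powr (1 / 4) * sqrt (ln (real d)) \<and>
      (\<exists>P. is_factor (stars_at_least l) G P)"
    using star_size_estimate[OF s2 s s1] by (intro exI[of _ ?l] conjI) simp_all
qed

end
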